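(* Let $\mathcal{A}$ be a unital $C^*$-algebra, let $\mathcal{F}\subseteq\mathcal{A}$ be an ideal of finite type elements, and let $a\in\mathcal{A}$. Then the following statements hold. 1) $a\in\mathcal{K}\Phi_{+}^{-}(\mathcal{A})$ if and only if there exist a left invertible element $b\in\mathcal{A}$ and some $f\in\mathcal{F}$ such that $a=b+f$. 2) $a\in\mathcal{K}\Phi_{-}^{+}(\mathcal{A})$ if and only if there exist a right invertible element $b\in\mathcal{A}$ and some $f\in\mathcal{F}$ such that $a=b+f$. 3) $a\in\mathcal{K}\Phi_{0}(\mathcal{A})$ if and only if there exist an invertible element $b\in\mathcal{A}$ and some $f\in\mathcal{F}$ such that $a=b+f$.
   Context: Ideal of finite type elements: a subalgebra $\mathcal{F}\subseteq\mathcal{A}$ such that (i) $\mathcal{F}$ is a selfadjoint ideal: $ab,ba\in\mathcal{F}$ for all $a\in\mathcal{A}$, $b\in\mathcal{F}$, and $a\in\mathcal{F}$ implies $a^*\in\mathcal{F}$; (ii) there is an approximate unit $(p_\alpha)$ (in the norm topology) for $\mathcal{F}$ consisting of projections; (iii) if $p,q\in\mathcal{F}$ are projections, then there exists $v\in\mathcal{A}$ such that $vv^*=q$ and $v^*v\perp p$, i.e. $v^*v+p$ is a projection. For projections $p,q\in\mathcal{A}$: $p\sim q$ means there is $v\in\mathcal{A}$ with $vv^*=p$, $v^*v=q$; $p\preceq q$ means there is a projection $p'\in\mathcal{A}$ with $p'\le q$ and $p\sim p'$. For $a\in\mathcal{A}$ and projections $p,q\in\mathcal{A}$, $a$ is invertible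 up to the pair $(p,q)$ if, with $a'=(1-q)a(1-p)$, there is $b\in\mathcal{A}$ with $b=(1-p)b(1-q)$, $a'b=1-q$, $ba'=1-p$. With respect to the fixed ideal $\mathcal{F}$: $\mathcal{K}\Phi_{+}^{-}(\mathcal{A})$ (upper semi-Weyl type), resp. $\mathcal{K}\Phi_{-}^{+}(\mathcal{A})$ (lower semi-Weyl type), resp. $\mathcal{K}\Phi_{0}(\mathcal{A})$ (Weyl type), is the set of $a\in\mathcal{A}$ that are invertible up to some pair $(p,q)$ of projections in $\mathcal{A}$ with $p\in\mathcal{F}$ and $p\preceq q$, resp. $q\in\mathcal{F}$ and $q\preceq p$, resp. $p,q\in\mathcal{F}$ and $p\sim q$. *)

theory Defs
  imports "HOL-Analysis.Analysis"
begin

text \<open>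
  Unital \<open>C\<^sup>*\<close>-algebras. The real scalar multiplication inherited from the library classes is
  the restriction of the complex one, and the unit has norm \<open>1\<close>, i.e. the zero algebra is excluded.
\<close>

class cstar_algebra = real_normed_algebra_1 + banach +
  fixes scaleC :: "complex \<Rightarrow> 'a \<Rightarrow> 'a" (infixr \<open>*\<^sub>C\<close> 75)
    and adj :: "'a \<Rightarrow> 'a" (\<open>_\<^sup>\<star>\<close> [1000] 999)
  assumes scaleR_scaleC: "r *\<^sub>R x = complex_of_real r *\<^sub>C x"
    and scaleC_add_right: "c *\<^sub>C (x + y) = c *\<^sub>C x + c *\<^sub>C y"
    and scaleC_add_left: "(c + d) *\<^sub>C x = c *\<^sub>C x + d *\<^sub>C x"
    and scaleC_scaleC: "c *\<^sub>C d *\<^sub>C x = (c * d) *\<^sub>C x"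
    and mult_scaleC_left: "(c *\<^sub>C x) * y = c *\<^sub>C (x * y)"
    and mult_scaleC_right: "x * (c *\<^sub>C y) = c *\<^sub>C (x * y)"
    and norm_scaleC: "norm (c *\<^sub>C x) = cmod c * norm x"
    and adj_adj: "(x\<^sup>\<star>)\<^sup>\<star> = x"
    and adj_add: "(x + y)\<^sup>\<star> = x\<^sup>\<star> + y\<^sup>\<star>"
    and adj_scaleC: "(c *\<^sub>C x)\<^sup>\<star> = cnj c *\<^sub>C x\<^sup>\<star>"
    and adj_mult: "(x * y)\<^sup>\<star> = y\<^sup>\<star> * x\<^sup>\<star>"
    and cstar_identity: "norm (x\<^sup>\<star> * x) = (norm x)\<^sup>2"

instantiation complex :: cstar_algebra
begin

definition scaleC_complex :: "complex \<Rightarrow> complex \<Rightarrow> complex" where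
  "scaleC_complex c x = c * x"

definition adj_complex :: "complex \<Rightarrow> complex" where
  "adj_complex x = cnj x"

instance
  by standard
    (simp_all add: scaleC_complex_def adj_complex_def scaleR_conv_of_real algebra_simps
      norm_mult power2_eq_square)

end

context cstar_algebra
begin

definition is_projection :: "'a \<Rightarrow> bool" where
  "is_projection p \<longleftrightarrow> p * p = p \<and> p\<^sup>\<star> = p"

definition proj_le :: "'a \<Rightarrow> 'a \<Rightarrow> bool" where
  "proj_le p q \<longleftrightarrow> p * q = p \<and> q * p = p"

definition proj_equiv :: "'a \<Rightarrow> 'a \<Rightarrow> bool" where
  "proj_equiv p q \<longleftrightarrow> (\<exists>v. v * v\<^sup>\<star> = p \<and> v\<^sup>\<star> * v = q)"

definition proj_subequiv :: "'a \<Rightarrow> 'a \<Rightarrow> bool" where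
  "proj_subequiv p q \<longleftrightarrow> (\<exists>p'. is_projection p' \<and> proj_le p' q \<and> proj_equiv p p')"

definition left_invertible :: "'a \<Rightarrow> bool" where
  "left_invertible b \<longleftrightarrow> (\<exists>c. c * b = 1)"

definition right_invertible :: "'a \<Rightarrow> bool" where
  "right_invertible b \<longleftrightarrow> (\<exists>c. b * c = 1)"

definition two_sided_invertible :: "'a \<Rightarrow> bool" where
  "two_sided_invertible b \<longleftrightarrow> (\<exists>c. c * b = 1 \<and> b * c = 1)"

definition subalgebra :: "'a set \<Rightarrow> bool" where
  "subalgebra F \<longleftrightarrow> 0 \<in> F \<and> (\<forall>x\<in>F. \<forall>y\<in>F. x + y \<in> F) \<and> (\<forall>c. \<forall>x\<in>F. c *\<^sub>C x \<in> F)
     \<and> (\<forall>x\<in>F. \<forall>y\<in>F. x * y \<in> F)"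

definition selfadjoint_ideal :: "'a set \<Rightarrow> bool" where
  "selfadjoint_ideal F \<longleftrightarrow> subalgebra F
     \<and> (\<forall>a. \<forall>b\<in>F. a * b \<in> F \<and> b * a \<in> F) \<and> (\<forall>a\<in>F. a\<^sup>\<star> \<in> F)"

end

definition directed_set :: "'i set \<Rightarrow> ('i \<Rightarrow> 'i \<Rightarrow> bool) \<Rightarrow> bool" where
  "directed_set I le \<longleftrightarrow> I \<noteq> {} \<and> (\<forall>i\<in>I. le i i)
     \<and> (\<forall>i\<in>I. \<forall>j\<in>I. \<forall>k\<in>I. le i j \<longrightarrow> le j k \<longrightarrow> le i k)
     \<and> (\<forall>i\<in>I. \<forall>j\<in>I. \<exists>k\<in>I. le i k \<and> le j k)"

definition net_tendsto ::
    "'i set \<Rightarrow> ('i \<Rightarrow> 'i \<Rightarrow> bool) \<Rightarrow> ('i \<Rightarrow> 'a::real_normed_vector) \<Rightarrow> 'a \<Rightarrow> bool" where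
  "net_tendsto I le x l \<longleftrightarrow> (\<forall>\<epsilon>>0. \<exists>i\<in>I. \<forall>j\<in>I. le i j \<longrightarrow> norm (x j - l) < \<epsilon>)"

definition approximate_unit ::
    "'a::cstar_algebra set \<Rightarrow> 'i set \<Rightarrow> ('i \<Rightarrow> 'i \<Rightarrow> bool) \<Rightarrow> ('i \<Rightarrow> 'a) \<Rightarrow> bool" where
  "approximate_unit F I le u \<longleftrightarrow> directed_set I le \<and> (\<forall>i\<in>I. u i \<in> F)
     \<and> (\<forall>x\<in>F. net_tendsto I le (\<lambda>i. u i * x) x \<and> net_tendsto I le (\<lambda>i. x * u i) x)"

text \<open>
  The index type of the net in the second condition cannot be quantified inside the definition;
  it is a parameter, so that a theorem with a free type \<open>'i\<close> covers nets over arbitrary index sets.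
  No norm-closedness of \<open>F\<close> and no monotonicity of the net is assumed.
\<close>

definition finite_type_ideal :: "'i itself \<Rightarrow> 'a::cstar_algebra set \<Rightarrow> bool" where
  "finite_type_ideal _ F \<longleftrightarrow> selfadjoint_ideal F
     \<and> (\<exists>(I :: 'i set) le u. approximate_unit F I le u \<and> (\<forall>i\<in>I. is_projection (u i)))
     \<and> (\<forall>p\<in>F. \<forall>q\<in>F. is_projection p \<longrightarrow> is_projection q \<longrightarrow>
          (\<exists>v. v * v\<^sup>\<star> = q \<and> is_projection (v\<^sup>\<star> * v + p)))"

context cstar_algebra
begin

definition invertible_up_to :: "'a \<Rightarrow> 'a \<Rightarrow> 'a \<Rightarrow> bool" where
  "invertible_up_to a p q \<longleftrightarrow>
     (let a' = (1 - q) * a * (1 - p)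
      in \<exists>b. b = (1 - p) * b * (1 - q) \<and> a' * b = 1 - q \<and> b * a' = 1 - p)"

definition upper_semi_Weyl :: "'a set \<Rightarrow> 'a set" where
  "upper_semi_Weyl F = {a. \<exists>p q. is_projection p \<and> is_projection q \<and> invertible_up_to a p q
     \<and> p \<in> F \<and> proj_subequiv p q}"

definition lower_semi_Weyl :: "'a set \<Rightarrow> 'a set" where
  "lower_semi_Weyl F = {a. \<exists>p q. is_projection p \<and> is_projection q \<and> invertible_up_to a p q
     \<and> q \<in> F \<and> proj_subequiv q p}"

definition Weyl :: "'a set \<Rightarrow> 'a set" where
  "Weyl F = {a. \<exists>p q. is_projection p \<and> is_projection q \<and> invertible_up_to a p q
     \<and> p \<in> F \<and> q \<in> F \<and> proj_equiv p q}"

end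

end

theory Submission
  imports Defs
begin

text \<open>
  If \<open>a\<close> is of semi-Weyl type up to \<open>(p, q)\<close> and \<open>v\<close> implements \<open>p \<preceq> q\<close>, then \<open>a (1 - p) + v\<^sup>\<star>\<close> is left
  invertible and differs from \<open>a\<close> by an element of \<open>F\<close>. Conversely, let \<open>a = b + f\<close> with \<open>b\<close> left
  invertible. Choosing \<open>p\<close> far out in the approximate unit, \<open>b\<close> can be perturbed so that it stays left
  invertible and \<open>a (1 - p) = b (1 - p)\<close>; take \<open>1 - q\<close> to be the range projection of \<open>b (1 - p)\<close>. Then
  \<open>q b p\<close> is left invertible relative to \<open>p\<close>, so \<open>p\<close> is algebraically equivalent to a projection
  \<open>p' \<le> q\<close> in \<open>F\<close>. To obtain Murray-von Neumann equivalence, condition (iii) replaces \<open>p'\<close> by a copy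
  orthogonal to \<open>p\<close>, and then a polar decomposition of a single selfadjoint invertible element
  suffices; this needs only that selfadjoint elements have real spectrum.
\<close>

section \<open>Elementary facts\<close>

lemma adj_zero [simp]: "(0::'a::cstar_algebra)\<^sup>\<star> = 0"
proof -
  have "(0::'a)\<^sup>\<star> + 0\<^sup>\<star> = 0\<^sup>\<star>"
    by (metis adj_add add_0)
  then show ?thesis by simp
qed

lemma adj_one [simp]: "(1::'a::cstar_algebra)\<^sup>\<star> = 1"
  by (metis adj_adj adj_mult mult_1_left mult_1_right)

lemma adj_minus: "(- x)\<^sup>\<star> = - (x::'a::cstar_algebra)\<^sup>\<star>"
  by (metis adj_add adj_zero add.right_inverse minus_unique)

lemma adj_diff: "(x - y)\<^sup>\<star> = x\<^sup>\<star> - (y::'a::cstar_algebra)\<^sup>\<star>"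
  by (metis adj_add adj_minus diff_conv_add_uminus)

lemma adj_scaleR: "(r *\<^sub>R x)\<^sup>\<star> = r *\<^sub>R (x::'a::cstar_algebra)\<^sup>\<star>"
  by (simp add: scaleR_scaleC adj_scaleC)

lemma scaleC_one [simp]: "1 *\<^sub>C x = (x::'a::cstar_algebra)"
  using scaleR_scaleC[of 1 x] by simp

lemma scaleC_minus_left: "(- c) *\<^sub>C x = - (c *\<^sub>C (x::'a::cstar_algebra))"
proof -
  have "0 *\<^sub>C x = 0" using scaleR_scaleC[of 0 x] by simp
  then have "c *\<^sub>C x + (- c) *\<^sub>C x = 0" by (simp flip: scaleC_add_left)
  then show ?thesis by (simp add: add_eq_0_iff)
qed

lemma scaleC_diff_right: "c *\<^sub>C (x - y) = c *\<^sub>C x - c *\<^sub>C (y::'a::cstar_algebra)"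
  by (metis diff_add_cancel eq_diff_eq scaleC_add_right)

lemmas adj_simps = adj_adj adj_add adj_diff adj_minus adj_mult adj_scaleC adj_scaleR

text \<open>The \<open>C\<^sup>*\<close>-identity and submultiplicativity give one inequality after
  cancelling \<open>norm y\<close>; applying it to \<open>x\<close> and to its adjoint gives
  both.\<close>

lemma norm_adj: "norm (x\<^sup>\<star>) = norm (x::'a::cstar_algebra)"
proof -
  have le: "norm y \<le> norm (y\<^sup>\<star>)" for y :: 'a
  proof (cases "y = 0")
    case False
    have "(norm y)\<^sup>2 \<le> norm (y\<^sup>\<star>) * norm y"
      by (metis cstar_identity norm_mult_ineq)
    then show ?thesis using False by (simp add: power2_eq_square)
  qed simp
  show ?thesis using le[of x] le[of "x\<^sup>\<star>"] by (simp add: adj_adj)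
qed

lemma continuous_on_adj: "continuous_on S (adj :: 'a::cstar_algebra \<Rightarrow> 'a)"
  by (rule continuous_onI) (metis adj_diff dist_norm norm_adj order_less_imp_le)

lemma cstar_identity': "norm (x * x\<^sup>\<star>) = (norm (x::'a::cstar_algebra))\<^sup>2"
  by (metis adj_adj cstar_identity norm_adj)

lemma norm_unitary:
  assumes "u\<^sup>\<star> * u = (1::'a::cstar_algebra)"
  shows "norm u = 1"
  using cstar_identity[of u] assms by (simp add: power2_eq_1_iff) (metis norm_ge_zero not_one_le_zero neg_0_le_iff_le)

text \<open>The geometric series in \<open>1 - t\<close> converges absolutely and sums to the
  inverse.\<close>

lemma neumann_inverse:
  fixes t :: "'a::{real_normed_algebra_1, banach}"
  assumes "norm (1 - t) < 1"
  obtains s where "s * t = 1" "t * s = 1"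
proof -
  define x where "x = 1 - t"
  have "summable (\<lambda>n. norm x ^ n)"
    using assms by (simp add: x_def)
  then have sm: "summable (\<lambda>n. x ^ n)"
    by (rule summable_comparison_test') (simp add: norm_power_ineq)
  have head: "(\<Sum>n. x ^ n) = 1 + (\<Sum>n. x ^ Suc n)"
    using suminf_split_head[OF sm] by simp
  have "(\<Sum>n. x ^ Suc n) = x * (\<Sum>n. x ^ n)"
    using suminf_mult[OF sm, of x] by simp
  moreover have "(\<Sum>n. x ^ Suc n) = (\<Sum>n. x ^ n) * x"
    using suminf_mult2[OF sm, of x] by (simp add: power_commutes)
  ultimately have "(1 - x) * (\<Sum>n. x ^ n) = 1" "(\<Sum>n. x ^ n) * (1 - x) = 1"
    using head by (simp_all add: algebra_simps)
  then show thesis using that by (simp add: x_def)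
qed

lemma inverse_unique_ring: "l * x = 1 \<Longrightarrow> x * r = 1 \<Longrightarrow> l = (r::'a::ring_1)"
  by (metis mult.assoc mult_1_left mult_1_right)

lemma commute_mult:
  fixes m :: "'a::semigroup_mult"
  assumes "m * x = x * m" "m * y = y * m"
  shows "m * (x * y) = x * y * m"
  by (metis assms mult.assoc)

lemma inverse_commute:
  fixes x :: "'a::ring_1"
  assumes "s * x = 1" "x * s = 1" "x * m = m * x"
  shows "s * m = m * s"
  by (metis assms mult.assoc mult_1_left mult_1_right)

lemma adj_inverse:
  fixes x :: "'a::cstar_algebra"
  assumes "s * x = 1" "x * s = 1" "x\<^sup>\<star> = x"
  shows "s\<^sup>\<star> = s"
  by (metis adj_mult adj_one assms inverse_unique_ring)

section \<open>Selfadjoint elements: invertibility and square roots\<close>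

text \<open>
  The Cayley transform of \<open>h + it\<close> is unitary, so the inverse has norm at most \<open>1/t\<close>. For
  \<open>t > norm h\<close> invertibility is clear, and this bound carries it over to \<open>h + i\<close>.
\<close>

lemma norm_inverse_selfadjoint_plus_imaginary:
  fixes h :: "'a::cstar_algebra"
  assumes h: "h\<^sup>\<star> = h" and t: "t > 0"
    and r: "r * (h + (\<i> * of_real t) *\<^sub>C 1) = 1" "(h + (\<i> * of_real t) *\<^sub>C 1) * r = 1"
  shows "norm r \<le> 1 / t"
proof -
  let ?w = "h + (\<i> * of_real t) *\<^sub>C 1"
  have w': "?w\<^sup>\<star> = h - (\<i> * of_real t) *\<^sub>C 1"
    by (simp add: adj_simps h scaleC_minus_left)
  have comm: "?w * ?w\<^sup>\<star> = ?w\<^sup>\<star> * ?w"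
    unfolding w' by (simp add: algebra_simps mult_scaleC_left mult_scaleC_right scaleC_add_right scaleC_diff_right)
  \<comment> \<open>The Cayley transform: \<open>?w\<close> is normal, so
    \<open>u\<^sup>\<star> * u\<close> collapses to \<open>1\<close>.\<close>
  define u where "u = ?w\<^sup>\<star> * r"
  have r': "r\<^sup>\<star> * ?w\<^sup>\<star> = 1"
    by (metis adj_mult adj_one r(2))
  have "u\<^sup>\<star> * u = r\<^sup>\<star> * (?w * ?w\<^sup>\<star>) * r"
    by (simp add: u_def adj_mult adj_adj mult.assoc)
  also have "\<dots> = (r\<^sup>\<star> * ?w\<^sup>\<star>) * (?w * r)"
    by (simp only: comm mult.assoc)
  finally have nu: "norm u = 1"
    by (intro norm_unitary) (simp add: r r')
  have "(2 * \<i> * of_real t) *\<^sub>C r = ?w * r - ?w\<^sup>\<star> * r"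
  proof -
    have "?w - ?w\<^sup>\<star> = (2 * \<i> * of_real t) *\<^sub>C 1"
    proof -
      have "2 * \<i> * of_real t = \<i> * of_real t + \<i> * of_real t" by simp
      then show ?thesis unfolding w' by (simp only: scaleC_add_left) simp
    qed
    then have "(?w - ?w\<^sup>\<star>) * r = (2 * \<i> * of_real t) *\<^sub>C r"
      by (simp only: mult_scaleC_left mult_1_left)
    then show ?thesis by (simp only: left_diff_distrib)
  qed
  then have "norm ((2 * \<i> * of_real t) *\<^sub>C r) \<le> norm (1::'a) + norm u"
    unfolding r(2) u_def[symmetric] by (simp only: norm_triangle_ineq4)
  then have "2 * t * norm r \<le> 2"
    using nu t by (simp add: norm_scaleC norm_mult)
  then show ?thesis using t by (simp add: field_simps)
qed

lemma selfadjoint_plus_i_inverse: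
  fixes h :: "'a::cstar_algebra"
  assumes h: "h\<^sup>\<star> = h"
  obtains r where "r * (h + \<i> *\<^sub>C 1) = 1" "(h + \<i> *\<^sub>C 1) * r = 1" "norm r \<le> 1"
proof -
  define t where "t = norm h + 1"
  have t: "t > 0" "t \<ge> 1" "norm h < t" by (auto simp: t_def add_nonneg_pos)
  have tinv: "(\<i> * of_real t) * (- \<i> / of_real t) = 1" "(- \<i> / of_real t) * (\<i> * of_real t) = 1"
    using t by (simp_all add: field_simps)
  let ?w = "h + (\<i> * of_real t) *\<^sub>C 1"
  \<comment> \<open>Factoring out the scalar leaves a perturbation of \<open>1\<close> by an element
    of norm \<open>norm h / t < 1\<close>.\<close>
  define g where "g = 1 + (- \<i> / of_real t) *\<^sub>C h"
  have wg: "?w = (\<i> * of_real t) *\<^sub>C g"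
    using tinv by (simp only: g_def scaleC_add_right scaleC_scaleC scaleC_one add.commute)
  have "norm (1 - g) < 1"
    using t by (simp add: g_def norm_scaleC norm_divide)
  then obtain s where s: "s * g = 1" "g * s = 1"
    by (rule neumann_inverse)
  define r where "r = (- \<i> / of_real t) *\<^sub>C s"
  have r: "r * ?w = 1" "?w * r = 1"
    unfolding r_def wg using tinv s
    by (simp_all only: mult_scaleC_left mult_scaleC_right scaleC_scaleC scaleC_one)
  have nr: "norm r \<le> 1 / t"
    by (rule norm_inverse_selfadjoint_plus_imaginary[OF h t(1) r])
  \<comment> \<open>The correction factor from \<open>?w\<close> to \<open>h + i\<close>. The bound
    on \<open>r\<close> gives \<open>norm (1 - k) \<le> (t - 1) / t < 1\<close>, so one Neumann step
    suffices.\<close>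
  define k where "k = 1 + (\<i> * of_real (1 - t)) *\<^sub>C r"
  have wk: "h + \<i> *\<^sub>C 1 = ?w + (\<i> * of_real (1 - t)) *\<^sub>C 1"
    by (simp add: algebra_simps flip: scaleC_add_left)
  have k1: "h + \<i> *\<^sub>C 1 = ?w * k" and k2: "h + \<i> *\<^sub>C 1 = k * ?w"
    by (simp_all only: wk k_def distrib_left[of ?w] distrib_right[of _ _ ?w] mult_scaleC_right
      mult_scaleC_left r mult_1_left mult_1_right)
  have "norm (1 - k) = (t - 1) * norm r"
    using t by (simp add: k_def norm_scaleC norm_mult flip: of_real_diff)
  also have "\<dots> \<le> (t - 1) * (1 / t)"
    using nr t by (intro mult_left_mono) auto
  also have "\<dots> < 1" using t by (simp add: field_simps)
  finally obtain l where l: "l * k = 1" "k * l = 1"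
    by (rule neumann_inverse)
  have L: "(l * r) * (h + \<i> *\<^sub>C 1) = 1"
    by (metis k1 l(1) mult.assoc mult_1_left r(1))
  have R: "(h + \<i> *\<^sub>C 1) * (r * l) = 1"
    by (metis k2 l(2) mult.assoc mult_1_left r(2))
  have eq: "l * r = r * l" using L R by (rule inverse_unique_ring)
  show thesis
    using that[of "r * l"] L R eq norm_inverse_selfadjoint_plus_imaginary[OF h, of 1 "r * l"]
    by simp
qed

text \<open>With \<open>r\<close> the inverse of \<open>h + i\<close>, the factorization
  \<open>1 + h\<^sup>2 = (h + i)(h - i)\<close> makes \<open>r\<^sup>\<star> * r\<close> the
  inverse, and \<open>norm r \<le> 1\<close> bounds it.\<close>

lemma one_plus_square_inverse:
  fixes h :: "'a::cstar_algebra"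
  assumes h: "h\<^sup>\<star> = h"
  obtains s where "s * (1 + h * h) = 1" "(1 + h * h) * s = 1" "norm s \<le> 1"
proof -
  obtain r where r: "r * (h + \<i> *\<^sub>C 1) = 1" "(h + \<i> *\<^sub>C 1) * r = 1" "norm r \<le> 1"
    using selfadjoint_plus_i_inverse[OF h] .
  let ?w = "h + \<i> *\<^sub>C 1"
  have w': "?w\<^sup>\<star> = h - \<i> *\<^sub>C 1"
    by (simp add: adj_simps h scaleC_minus_left)
  have z: "1 + h * h = ?w * ?w\<^sup>\<star>" "1 + h * h = ?w\<^sup>\<star> * ?w"
    unfolding w' by (simp_all add: algebra_simps mult_scaleC_left mult_scaleC_right scaleC_scaleC scaleC_minus_left scaleC_add_right scaleC_diff_right)
  have r': "r\<^sup>\<star> * ?w\<^sup>\<star> = 1" "?w\<^sup>\<star> * r\<^sup>\<star> = 1"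
    by (metis adj_mult adj_one r)+
  have "(r\<^sup>\<star> * r) * (1 + h * h) = r\<^sup>\<star> * (r * ?w) * ?w\<^sup>\<star>"
    by (simp only: z(1) mult.assoc)
  moreover have "(1 + h * h) * (r\<^sup>\<star> * r) = ?w * (?w\<^sup>\<star> * r\<^sup>\<star>) * r"
    by (simp only: z(1) mult.assoc)
  moreover have "norm (r\<^sup>\<star> * r) \<le> 1"
    using r(3) by (simp add: cstar_identity power_le_one)
  ultimately show thesis
    using that[of "r\<^sup>\<star> * r"] r r' by simp
qed

text \<open>
  With \<open>k\<close> the inverse of \<open>h\<close> and \<open>g = h - \<delta>k\<close> we have \<open>h\<^sup>2 = g\<^sup>2 + 2\<delta> - \<delta>\<^sup>2k\<^sup>2\<close>, which improves the
  bound \<open>norm (1 + \<epsilon>h\<^sup>2)\<^sup>-\<^sup>1 \<le> 1\<close> to a strict one; and \<open>1 - \<epsilon>h\<^sup>2\<close> agrees with this inverse up to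
  \<open>O(\<epsilon>\<^sup>2)\<close>.
\<close>

lemma norm_one_minus_square_less_one:
  fixes h :: "'a::cstar_algebra"
  assumes h: "h\<^sup>\<star> = h" and k: "k * h = 1" "h * k = 1"
  obtains e where "e > 0" "norm (1 - e *\<^sub>R (h * h)) < 1"
proof -
  define z where "z = h * h"
  \<comment> \<open>Small enough that the error term with \<open>\<delta>\<^sup>2 k\<^sup>2\<close>
    costs only half of the gain \<open>2\<delta>\<close>.\<close>
  define \<delta> where "\<delta> = 1 / (norm (k * k) + 1)"
  have \<delta>: "\<delta> > 0" "\<delta> * norm (k * k) \<le> 1"
    by (simp_all add: \<delta>_def add_nonneg_pos divide_le_eq)
  define g where "g = h - \<delta> *\<^sub>R k"
  have g: "g\<^sup>\<star> = g"
    using adj_inverse[OF k h] h by (simp add: g_def adj_simps)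
  have zg: "z = g * g + (2 * \<delta>) *\<^sub>R 1 - (\<delta> * \<delta>) *\<^sub>R (k * k)"
    unfolding z_def g_def using k by (simp add: algebra_simps flip: scaleR_2)
  \<comment> \<open>The first bound yields \<open>norm R \<le> 1 - e\<delta>/2\<close>; the second
    keeps the quadratic error \<open>e\<^sup>2 (norm z)\<^sup>2\<close> strictly below
    \<open>e\<delta>/2\<close>.\<close>
  define e where "e = min (1 / \<delta>) (\<delta> / (2 * ((norm z)\<^sup>2 + 1)))"
  have e: "e > 0" "e * \<delta> \<le> 1" "2 * e * ((norm z)\<^sup>2 + 1) \<le> \<delta>"
  proof -
    have N: "(norm z)\<^sup>2 + 1 > 0" by (simp add: add_nonneg_pos)
    show "e > 0" using \<delta> N by (simp add: e_def)
    have "e \<le> 1 / \<delta>" "e \<le> \<delta> / (2 * ((norm z)\<^sup>2 + 1))" by (simp_all add: e_def)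
    then show "e * \<delta> \<le> 1" "2 * e * ((norm z)\<^sup>2 + 1) \<le> \<delta>"
      using \<delta> N by (simp_all add: field_simps)
  qed
  have "(sqrt e *\<^sub>R h)\<^sup>\<star> = sqrt e *\<^sub>R h" by (simp add: adj_scaleR h)
  then obtain R where R0: "R * (1 + (sqrt e *\<^sub>R h) * (sqrt e *\<^sub>R h)) = 1"
      "(1 + (sqrt e *\<^sub>R h) * (sqrt e *\<^sub>R h)) * R = 1" "norm R \<le> 1"
    by (rule one_plus_square_inverse)
  have "(sqrt e *\<^sub>R h) * (sqrt e *\<^sub>R h) = e *\<^sub>R z" using e by (simp add: z_def)
  with R0 have R: "R * (1 + e *\<^sub>R z) = 1" "(1 + e *\<^sub>R z) * R = 1" "norm R \<le> 1" by simp_all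
  \<comment> \<open>The scalar part of \<open>1 + e z\<close> once \<open>z\<close> is expressed
    through \<open>g\<close>; dividing by it allows the bound \<open>norm Q \<le> 1\<close> for
    \<open>g\<close>.\<close>
  define c where "c = 1 + 2 * e * \<delta>"
  have c: "c > 0" using e \<delta> by (simp add: c_def add_pos_pos)
  have "(sqrt (e / c) *\<^sub>R g)\<^sup>\<star> = sqrt (e / c) *\<^sub>R g" by (simp add: adj_scaleR g)
  then obtain Q where Q0: "Q * (1 + (sqrt (e / c) *\<^sub>R g) * (sqrt (e / c) *\<^sub>R g)) = 1" "norm Q \<le> 1"
    by (rule one_plus_square_inverse)
  have "(sqrt (e / c) *\<^sub>R g) * (sqrt (e / c) *\<^sub>R g) = (e / c) *\<^sub>R (g * g)" using e c by simp
  with Q0 have Q: "Q * (1 + (e / c) *\<^sub>R (g * g)) = 1" by (simp only:)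
  have zc: "1 + e *\<^sub>R z = c *\<^sub>R (1 + (e / c) *\<^sub>R (g * g)) - (e * \<delta> * \<delta>) *\<^sub>R (k * k)"
  proof -
    have "c *\<^sub>R (1 + (e / c) *\<^sub>R (g * g)) = c *\<^sub>R 1 + e *\<^sub>R (g * g)"
      using c by (simp add: scaleR_add_right)
    then show ?thesis by (simp only:) (simp add: zg algebra_simps c_def)
  qed
  \<comment> \<open>A resolvent identity comparing \<open>R\<close> with \<open>Q\<close>.\<close>
  have "Q = Q * ((1 + e *\<^sub>R z) * R)" by (simp add: R)
  also have "\<dots> = Q * (1 + e *\<^sub>R z) * R" by (simp only: mult.assoc)
  also have "\<dots> = (c *\<^sub>R 1 - (e * \<delta> * \<delta>) *\<^sub>R (Q * (k * k))) * R"
    unfolding zc right_diff_distrib mult_scaleR_right Q ..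
  finally have "c *\<^sub>R R = Q + (e * \<delta> * \<delta>) *\<^sub>R (Q * (k * k) * R)"
    by (simp add: algebra_simps)
  then have "c * norm R \<le> norm Q + (e * \<delta> * \<delta>) * norm (Q * (k * k) * R)"
    using c e \<delta> by (metis abs_of_pos mult_pos_pos norm_scaleR norm_triangle_ineq)
  also have "\<dots> \<le> 1 + (e * \<delta> * \<delta>) * (1 * norm (k * k) * norm R)"
    using e \<delta> Q0(2) by (intro add_mono mult_left_mono order_trans[OF norm_mult_ineq] mult_right_mono) auto
  also have "\<dots> = 1 + (e * \<delta>) * (\<delta> * norm (k * k)) * norm R" by simp
  also have "\<dots> \<le> 1 + (e * \<delta>) * 1 * norm R"
    using e \<delta> by (intro add_mono mult_left_mono mult_right_mono) auto
  finally have bR: "(1 + e * \<delta>) * norm R \<le> 1" by (simp add: c_def algebra_simps)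
  have "1 - e *\<^sub>R z = ((1 - e *\<^sub>R z) * (1 + e *\<^sub>R z)) * R" by (simp add: mult.assoc R)
  also have "\<dots> = R - (e * e) *\<^sub>R (z * z * R)" by (simp add: algebra_simps)
  finally have "norm (1 - e *\<^sub>R z) \<le> norm R + (e * e) * norm (z * z * R)"
    using norm_triangle_ineq4[of R "(e * e) *\<^sub>R (z * z * R)"] by simp
  also have "norm (z * z * R) \<le> norm z * norm z * 1"
    using R(3) by (intro order_trans[OF norm_mult_ineq] mult_mono) (auto simp: norm_mult_ineq)
  finally have b1: "norm (1 - e *\<^sub>R z) \<le> norm R + (e * e) * (norm z)\<^sup>2"
    using e by (simp add: power2_eq_square mult_left_mono)
  have x: "2 * e * (e * ((norm z)\<^sup>2 + 1)) \<le> e * \<delta>"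
    using mult_left_mono[OF e(3), of e] e by (simp add: mult_ac)
  have "norm R \<le> 1 - e * \<delta> / 2"
  proof -
    have ed: "0 < e * \<delta>" using e \<delta> by simp
    have "0 \<le> (e * \<delta>) * (1 - e * \<delta>)" using ed e \<delta>(1) by (intro mult_nonneg_nonneg) auto
    then have "1 \<le> (1 + e * \<delta>) * (1 - e * \<delta> / 2)" by (simp add: algebra_simps)
    with bR have "(1 + e * \<delta>) * norm R \<le> (1 + e * \<delta>) * (1 - e * \<delta> / 2)" by linarith
    then show ?thesis using ed by simp
  qed
  moreover have "(e * e) * (norm z)\<^sup>2 < e * \<delta> / 2"
  proof -
    have "e * e > 0" using e by simp
    then show ?thesis using x by (simp add: algebra_simps)
  qed
  ultimately have "norm (1 - e *\<^sub>R z) < 1" using b1 by linarith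
  with e(1) show thesis using that by (simp add: z_def)
qed

text \<open>With \<open>s = 1 - y\<close> and \<open>d = 1 - x\<close>, the equation
  \<open>s\<^sup>2 = x\<close> becomes the fixed point equation
  \<open>y = (d + y\<^sup>2) / 2\<close>, solved by Banach's theorem.\<close>

lemma sqrt_near_one:
  fixes x :: "'a::cstar_algebra"
  assumes x: "x\<^sup>\<star> = x" and nx: "norm (1 - x) < 1"
  obtains s where "s\<^sup>\<star> = s" "s * s = x" "\<And>m. m * x = x * m \<Longrightarrow> m * s = s * m"
proof -
  define d where "d = 1 - x"
  define c where "c = norm d"
  have c: "0 \<le> c" "c < 1" using nx by (auto simp: c_def d_def)
  \<comment> \<open>Selfadjointness and commutation with the commutant of \<open>x\<close> are
    closed conditions preserved by \<open>f\<close>; built into the domain, they pass to the fixed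
    point.\<close>
  define S where "S = cball 0 c \<inter> {y. y\<^sup>\<star> = y} \<inter> (\<Inter>m\<in>{m. m * x = x * m}. {y. m * y = y * m})"
  define f where "f y = (1/2) *\<^sub>R (d + y * y)" for y
  have "closed S"
    unfolding S_def
    by (intro closed_Int closed_INT ballI closed_cball closed_Collect_eq continuous_on_adj continuous_intros)
  then have "complete S" by (simp add: complete_eq_closed)
  moreover have "0 \<in> S" using c by (simp add: S_def)
  moreover have "f ` S \<subseteq> S"
  proof safe
    fix y assume y: "y \<in> S"
    have "norm (d + y * y) \<le> c + c * 1"
      using y c by (intro order_trans[OF norm_triangle_ineq] add_mono order_trans[OF norm_mult_ineq] mult_mono)
        (auto simp: S_def c_def[symmetric])
    then have "norm (f y) \<le> c" by (simp add: f_def)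
    moreover have "(f y)\<^sup>\<star> = f y"
    proof -
      have "y\<^sup>\<star> = y" using y unfolding S_def by blast
      then show ?thesis using x by (simp add: f_def d_def adj_simps)
    qed
    moreover have "m * f y = f y * m" if "m * x = x * m" for m
    proof -
      have my: "m * y = y * m" using y that unfolding S_def by blast
      have "m * (y * y) = y * y * m" by (rule commute_mult[OF my my])
      then show ?thesis by (simp add: f_def d_def left_diff_distrib right_diff_distrib distrib_left distrib_right that)
    qed
    ultimately show "f y \<in> S" unfolding S_def by auto
  qed
  moreover have "dist (f y) (f w) \<le> c * dist y w" if "y \<in> S" "w \<in> S" for y w
  proof -
    have "f y - f w = (1/2) *\<^sub>R (y * (y - w) + (y - w) * w)" by (simp add: f_def algebra_simps)
    also have "norm \<dots> \<le> (1/2) * (norm y * norm (y - w) + norm (y - w) * norm w)"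
      using norm_triangle_ineq[of "y * (y - w)" "(y - w) * w"] norm_mult_ineq[of y "y - w"]
        norm_mult_ineq[of "y - w" w] by simp
    also have "\<dots> \<le> (1/2) * (c * norm (y - w) + norm (y - w) * c)"
      using that by (intro mult_left_mono add_mono mult_right_mono) (auto simp: S_def)
    finally show ?thesis by (simp add: dist_norm mult.commute)
  qed
  ultimately obtain y where y: "y \<in> S" "f y = y"
    using Banach_fix[of S c f] c by blast
  have "2 *\<^sub>R f y = 2 *\<^sub>R y" using y by simp
  then have "d + y * y = y + y" by (simp add: f_def scaleR_2)
  then have "(1 - y) * (1 - y) = x" by (simp add: d_def algebra_simps)
  moreover have "m * (1 - y) = (1 - y) * m" if "m * x = x * m" for m
  proof -
    have "m * y = y * m" using y(1) that unfolding S_def by blast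
    then show ?thesis by (simp add: left_diff_distrib right_diff_distrib)
  qed
  moreover have "(1 - y)\<^sup>\<star> = 1 - y"
  proof -
    have "y\<^sup>\<star> = y" using y(1) unfolding S_def by blast
    then show ?thesis by (simp add: adj_diff)
  qed
  ultimately show thesis using that by blast
qed

text \<open>The unitary part \<open>v\<close> of \<open>h\<close> is \<open>h\<close> times an
  inverse square root \<open>w\<close> of \<open>h\<^sup>2\<close>. That \<open>w\<close> commutes
  with the whole commutant of \<open>h\<^sup>2\<close> lets \<open>v\<close> inherit intertwining
  relations from \<open>h\<close>.\<close>

lemma symmetry_of_selfadjoint:
  fixes h :: "'a::cstar_algebra"
  assumes h: "h\<^sup>\<star> = h" and k: "k * h = 1" "h * k = 1"
  obtains v w where "v\<^sup>\<star> = v" "v * v = 1" "v = h * w" "\<And>m. m * (h * h) = h * h * m \<Longrightarrow> m * w = w * m"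
proof -
  obtain e where e: "e > 0" "norm (1 - e *\<^sub>R (h * h)) < 1"
    using norm_one_minus_square_less_one[OF assms] .
  have "(e *\<^sub>R (h * h))\<^sup>\<star> = e *\<^sub>R (h * h)" by (simp add: adj_simps h)
  then obtain s where s: "s\<^sup>\<star> = s" "s * s = e *\<^sub>R (h * h)"
      "\<And>m. m * (e *\<^sub>R (h * h)) = e *\<^sub>R (h * h) * m \<Longrightarrow> m * s = s * m"
    using sqrt_near_one e(2) by blast
  have sc: "m * s = s * m" if "m * (h * h) = h * h * m" for m
    using s(3)[of m] that by simp
  have hs: "h * s = s * h" by (rule sc) (simp add: mult.assoc)
  have ks: "k * s = s * k"
    by (rule inverse_commute[OF k hs])
  \<comment> \<open>The inverse of \<open>s\<close>, written as \<open>s\<close> times the inverse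
    of \<open>s\<^sup>2 = e h\<^sup>2\<close>.\<close>
  define w where "w = (1 / e) *\<^sub>R (s * (k * k))"
  have kk: "k * k * (h * h) = 1" "h * h * (k * k) = 1"
    by (metis k mult.assoc mult_1_right)+
  have ssk: "s * s * (k * k) = e *\<^sub>R 1" by (simp add: s(2) kk)
  have kks: "k * k * s = s * (k * k)"
    by (rule commute_mult[OF ks[symmetric] ks[symmetric], symmetric])
  have "s * (k * k) * s = s * (k * k * s)" by (simp only: mult.assoc)
  also have "\<dots> = s * s * (k * k)" by (simp only: kks) (simp only: mult.assoc)
  finally have sw: "s * w = 1" "w * s = 1"
    using e ssk by (simp_all add: w_def mult.assoc)
  have ws: "w\<^sup>\<star> = w" by (rule adj_inverse[OF sw(2,1) s(1)])
  have cw: "m * w = w * m" if "m * (h * h) = h * h * m" for m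
    by (rule inverse_commute[OF sw(2,1) sc[OF that, symmetric], symmetric])
  have hw: "h * w = w * h" by (rule cw) (simp add: mult.assoc)
  have "h * w * (h * w) = h * (w * h) * w" by (simp only: mult.assoc)
  also have "\<dots> = (h * h) * (w * w)" by (simp only: hw[symmetric]) (simp only: mult.assoc)
  also have "h * h = (1 / e) *\<^sub>R (s * s)" using e by (simp add: s(2))
  also have "(1 / e) *\<^sub>R (s * s) * (w * w) = (1 / e) *\<^sub>R 1"
  proof -
    have "s * s * (w * w) = s * (s * w) * w" by (simp only: mult.assoc)
    then show ?thesis by (simp add: sw)
  qed
  finally have v2: "(h * w) * (h * w) = (1 / e) *\<^sub>R 1" .
  \<comment> \<open>The factor \<open>sqrt e\<close> undoes the scaling of \<open>h\<^sup>2\<close>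
    that brought it near \<open>1\<close>.\<close>
  show thesis
  proof (rule that[of "h * (sqrt e *\<^sub>R w)" "sqrt e *\<^sub>R w"])
    show "(h * (sqrt e *\<^sub>R w))\<^sup>\<star> = h * (sqrt e *\<^sub>R w)"
      by (simp add: adj_simps h ws hw)
    show "h * (sqrt e *\<^sub>R w) * (h * (sqrt e *\<^sub>R w)) = 1" using v2 e by simp
    show "m * (sqrt e *\<^sub>R w) = sqrt e *\<^sub>R w * m" if "m * (h * h) = h * h * m" for m
      using cw[OF that] by simp
  qed simp
qed

section \<open>Projections\<close>

lemma mult_eq_assoc: "x * y = z \<Longrightarrow> x * (y * w) = z * (w::'a::semigroup_mult)"
  by (simp flip: mult.assoc)

lemma is_projection_complement:
  "is_projection p \<Longrightarrow> is_projection (1 - p::'a::cstar_algebra)"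
  by (simp add: is_projection_def adj_diff algebra_simps)

text \<open>Kaplansky's formula for the range projection: \<open>e e\<^sup>\<star> (1 - (e - e\<^sup>\<star>)\<^sup>2)\<^sup>-\<^sup>1\<close>.\<close>

lemma range_projection:
  fixes e :: "'a::cstar_algebra"
  assumes e: "e * e = e"
  obtains r where "is_projection r" "r * e = e" "e * r = r"
proof -
  let ?f = "e\<^sup>\<star>"
  have f: "?f * ?f = ?f" by (metis adj_mult e)
  \<comment> \<open>The factor \<open>\<i>\<close> makes \<open>h\<close> selfadjoint and turns
    \<open>1 + h\<^sup>2\<close> into the denominator \<open>z\<close> of the formula, which is
    therefore invertible.\<close>
  define h where "h = \<i> *\<^sub>C (e - ?f)"
  define z where "z = 1 + h * h"
  have h: "h\<^sup>\<star> = h"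
    by (simp add: h_def adj_simps scaleC_minus_left scaleC_diff_right)
  have "h * h = - ((e - ?f) * (e - ?f))"
    by (simp add: h_def mult_scaleC_left mult_scaleC_right scaleC_scaleC scaleC_minus_left)
  then have z: "z = 1 - e - ?f + e * ?f + ?f * e"
    by (simp add: z_def algebra_simps e f)
  \<comment> \<open>Thus \<open>z\<close>, and so its inverse, commutes with \<open>e\<close>; the
    value \<open>e * ?f * e\<close> is what makes \<open>r * e\<close> reduce to
    \<open>e\<close>.\<close>
  have ez: "e * z = e * ?f * e" and ze: "z * e = e * ?f * e"
    by (simp_all add: z algebra_simps e f mult_eq_assoc[OF e] mult_eq_assoc[OF f])
  have fz: "z * ?f = ?f * z"
    by (simp add: z algebra_simps e f mult_eq_assoc[OF e] mult_eq_assoc[OF f])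
  obtain s where s: "s * z = 1" "z * s = 1"
    using one_plus_square_inverse[OF h] unfolding z_def by blast
  have zs: "z\<^sup>\<star> = z" by (simp add: z_def adj_simps h)
  have ss: "s\<^sup>\<star> = s" by (rule adj_inverse[OF s zs])
  have se: "s * e = e * s" by (rule inverse_commute[OF s]) (simp only: ez ze)
  have sf: "s * ?f = ?f * s" by (rule inverse_commute[OF s fz])
  have sef: "s * (e * ?f) = e * ?f * s" by (rule commute_mult[OF se sf])
  define r where "r = e * ?f * s"
  have er: "e * r = r" by (simp add: r_def e flip: mult.assoc)
  have "r * e = e * ?f * (s * e)" by (simp only: r_def mult.assoc)
  also have "\<dots> = (e * ?f * e) * s" by (simp only: se mult.assoc)
  also have "\<dots> = e" by (simp only: ez[symmetric]) (simp add: mult.assoc s)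
  finally have re: "r * e = e" .
  have "r * r = (r * e) * ?f * s" by (simp only: r_def mult.assoc)
  then have "r * r = r" by (simp only: re) (simp only: r_def)
  moreover have "r\<^sup>\<star> = r" by (simp add: r_def adj_simps ss sef)
  ultimately show thesis using that er re by (simp add: is_projection_def)
qed

section \<open>Partial isometries and Murray-von Neumann equivalence\<close>

lemma proj_equiv_sym: "proj_equiv p q \<Longrightarrow> proj_equiv q (p::'a::cstar_algebra)"
  unfolding proj_equiv_def by (metis adj_adj)

text \<open>The element \<open>(1 - p) * v\<close> vanishes by the
  \<open>C\<^sup>*\<close>-identity, since its product with its adjoint is
  \<open>(1 - p) * p * (1 - p) = 0\<close>.\<close>

lemma proj_mult_partial_isometry:
  fixes v :: "'a::cstar_algebra"
  assumes "is_projection (v * v\<^sup>\<star>)"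
  shows "v * v\<^sup>\<star> * v = v"
proof -
  define p where "p = v * v\<^sup>\<star>"
  have p: "p * p = p" "p\<^sup>\<star> = p" using assms by (simp_all add: p_def is_projection_def)
  have "((1 - p) * v) * ((1 - p) * v)\<^sup>\<star> = (1 - p) * p * (1 - p)"
    by (simp add: adj_simps p) (simp add: p_def mult.assoc)
  also have "\<dots> = 0" by (simp add: algebra_simps p)
  finally have "(1 - p) * v = 0"
    using cstar_identity'[of "(1 - p) * v"] by simp
  then show ?thesis by (simp add: left_diff_distrib p_def)
qed

lemma is_projection_partial_isometry:
  fixes v :: "'a::cstar_algebra"
  assumes "is_projection (v * v\<^sup>\<star>)"
  shows "is_projection (v\<^sup>\<star> * v)"
  using proj_mult_partial_isometry[OF assms] by (simp add: is_projection_def adj_simps mult.assoc)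

lemma proj_equiv_trans:
  fixes p q r :: "'a::cstar_algebra"
  assumes "is_projection p" "is_projection r" "proj_equiv p q" "proj_equiv q r"
  shows "proj_equiv p r"
proof -
  obtain v w where v: "v * v\<^sup>\<star> = p" "v\<^sup>\<star> * v = q" and w: "w * w\<^sup>\<star> = q" "w\<^sup>\<star> * w = r"
    using assms unfolding proj_equiv_def by blast
  have "(v * w) * (v * w)\<^sup>\<star> = v * (w * w\<^sup>\<star>) * v\<^sup>\<star>" by (simp add: adj_mult mult.assoc)
  also have "\<dots> = (v * v\<^sup>\<star>) * (v * v\<^sup>\<star>)" by (simp only: w v(2)[symmetric] mult.assoc)
  also have "\<dots> = p" using assms(1) by (simp add: v is_projection_def)
  finally have 1: "(v * w) * (v * w)\<^sup>\<star> = p" .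
  have "(v * w)\<^sup>\<star> * (v * w) = w\<^sup>\<star> * (v\<^sup>\<star> * v) * w" by (simp add: adj_mult mult.assoc)
  also have "\<dots> = (w\<^sup>\<star> * w) * (w\<^sup>\<star> * w)" by (simp only: v w(1)[symmetric] mult.assoc)
  also have "\<dots> = r" using assms(2) by (simp add: w is_projection_def)
  finally show ?thesis using 1 unfolding proj_equiv_def by blast
qed

text \<open>Idempotence of the sum gives \<open>p q + q p = 0\<close>; multiplying by
  \<open>p\<close> on either side shows that \<open>p\<close> and \<open>q\<close> commute, so
  \<open>2 p q = 0\<close>. This extracts orthogonality from condition (iii).\<close>

lemma orthogonal_of_projection_sum:
  fixes p q :: "'a::cstar_algebra"
  assumes "is_projection p" "is_projection q" "is_projection (p + q)"
  shows "p * q = 0"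
proof -
  have pq: "p * p = p" "q * q = q" using assms by (simp_all add: is_projection_def)
  have sum: "p * q + q * p = 0"
    using assms(3) by (simp add: is_projection_def algebra_simps pq)
  have "p * (p * q + q * p) = 0" "(p * q + q * p) * p = 0" by (simp_all add: sum)
  then have "p * q + p * q * p = 0" "p * q * p + q * p = 0"
    by (simp_all add: distrib_left distrib_right mult.assoc pq mult_eq_assoc[OF pq(1)])
  then have "p * q = q * p" by (metis add.commute add_left_cancel)
  then have "(2::real) *\<^sub>R (p * q) = 0" using sum by (simp add: scaleR_2)
  then show ?thesis by simp
qed

text \<open>
  The orthogonality makes \<open>h = y + y\<^sup>\<star> + (1 - p - q)\<close> a selfadjoint invertible element exchanging
  \<open>p\<close> and \<open>q\<close>; its symmetry does the same and is unitary. This avoids the positivity of \<open>y\<^sup>\<star> y\<close>.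
\<close>

lemma orthogonal_proj_equiv:
  fixes p q y d :: "'a::cstar_algebra"
  assumes p: "is_projection p" and q: "is_projection q" and pq: "p * q = 0"
    and y: "q * y = y" "y * p = y" and d: "p * d = d" "d * q = d"
    and dy: "d * y = p" and yd: "y * d = q"
  shows "proj_equiv q p"
proof -
  have ps: "p * p = p" "p\<^sup>\<star> = p" and qs: "q * q = q" "q\<^sup>\<star> = q"
    using p q by (simp_all add: is_projection_def)
  have qp: "q * p = 0" by (metis adj_mult adj_zero pq ps(2) qs(2))
  have yq: "y * q = 0" by (metis y(2) mult.assoc pq mult_zero_right)
  have py: "p * y = 0" by (metis y(1) mult.assoc pq mult_zero_left)
  have dp: "d * p = 0" by (metis d(2) mult.assoc qp mult_zero_right)
  have qd: "q * d = 0" by (metis d(1) mult.assoc qp mult_zero_left)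
  have yd': "y * d\<^sup>\<star> = 0"
    by (metis y(2) mult.assoc dp adj_mult adj_zero ps(2) mult_zero_right)
  have y'd: "y\<^sup>\<star> * d = 0"
    by (metis d(1) mult.assoc py adj_mult adj_zero ps(2) mult_zero_left)
  have y'd': "y\<^sup>\<star> * d\<^sup>\<star> = p" by (metis adj_mult dy ps(2))
  have y'p: "y\<^sup>\<star> * p = 0" by (metis adj_mult py ps(2) adj_zero)
  have y'q: "y\<^sup>\<star> * q = y\<^sup>\<star>" by (metis adj_mult y(1) qs(2))
  have qy': "q * y\<^sup>\<star> = 0" by (metis adj_mult yq qs(2) adj_zero)
  have pd': "p * d\<^sup>\<star> = 0" by (metis adj_mult dp ps(2) adj_zero)
  have qd': "q * d\<^sup>\<star> = d\<^sup>\<star>" by (metis adj_mult d(2) qs(2))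
  define h where "h = y + y\<^sup>\<star> + (1 - p - q)"
  \<comment> \<open>Since \<open>d\<close> inverts \<open>y\<close> between the corners of
    \<open>p\<close> and \<open>q\<close>, the same recipe applied to \<open>d\<close> gives the
    inverse of \<open>h\<close>.\<close>
  define k where "k = d + d\<^sup>\<star> + (1 - p - q)"
  have hk: "h * k = 1"
    by (simp add: h_def k_def distrib_left distrib_right left_diff_distrib right_diff_distrib
        yd yd' y yq y'd y'd' y'p y'q d qd pd' qd' ps qs pq qp)
  have h: "h\<^sup>\<star> = h" and k: "k\<^sup>\<star> = k"
    by (simp_all add: h_def k_def adj_simps ps qs add.commute)
  have kh: "k * h = 1" by (metis adj_mult adj_one h hk k)
  obtain v w where v: "v\<^sup>\<star> = v" "v * v = 1" "v = h * w"
    and w: "\<And>m. m * (h * h) = h * h * m \<Longrightarrow> m * w = w * m"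
    using symmetry_of_selfadjoint[OF h kh hk] by blast
  have hp: "h * p = q * h"
    by (simp add: h_def distrib_left distrib_right left_diff_distrib right_diff_distrib
        y y'p qy' ps qs pq qp)
  then have ph: "p * h = h * q" by (metis adj_mult h ps(2) qs(2))
  \<comment> \<open>Exchanging twice fixes \<open>p\<close>, so \<open>w\<close> commutes with
    \<open>p\<close> and \<open>v = h * w\<close> still carries \<open>p\<close> to
    \<open>q\<close>.\<close>
  have "p * (h * h) = h * h * p" by (metis hp ph mult.assoc)
  then have pw: "p * w = w * p" by (rule w)
  have vp: "v * p = q * v" by (metis v(3) pw hp mult.assoc)
  have "(v * p) * (v * p)\<^sup>\<star> = v * p * v"
    by (simp add: adj_mult v(1) ps mult.assoc mult_eq_assoc[OF ps(1)])
  also have "\<dots> = q" by (simp add: vp mult.assoc v(2))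
  finally have 1: "(v * p) * (v * p)\<^sup>\<star> = q" .
  have "(v * p)\<^sup>\<star> * (v * p) = p * (v * v) * p" by (simp add: adj_mult v(1) ps mult.assoc)
  also have "\<dots> = p" by (simp add: v(2) ps)
  finally show ?thesis using 1 unfolding proj_equiv_def by blast
qed

text \<open>Condition (iii) supplies a copy of \<open>q\<close> orthogonal to \<open>p\<close>.\<close>

lemma finite_type_proj_equiv:
  fixes p q y d :: "'a::cstar_algebra"
  assumes F: "finite_type_ideal TYPE('i) F" and pF: "p \<in> F" "q \<in> F"
    and p: "is_projection p" and q: "is_projection q"
    and y: "q * y = y" "y * p = y" and d: "p * d = d" "d * q = d"
    and dy: "d * y = p" and yd: "y * d = q"
  shows "proj_equiv p q"
proof -
  obtain v where v: "v * v\<^sup>\<star> = q" "is_projection (v\<^sup>\<star> * v + p)"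
    using F pF p q unfolding finite_type_ideal_def by blast
  define r where "r = v\<^sup>\<star> * v"
  have r: "is_projection r"
    unfolding r_def by (rule is_projection_partial_isometry) (simp add: v q)
  have pr: "p * r = 0"
    using orthogonal_of_projection_sum[OF p r] v(2) by (simp add: r_def add.commute)
  have qv: "q * v = v"
    using proj_mult_partial_isometry[of v] q by (simp add: v)
  have vq: "v\<^sup>\<star> * q = v\<^sup>\<star>" by (metis adj_mult qv q is_projection_def)
  \<comment> \<open>Transporting \<open>y\<close> and \<open>d\<close> along \<open>v\<close> gives
    mutually inverse elements between \<open>p\<close> and the orthogonal projection
    \<open>r\<close>.\<close>
  have "proj_equiv r p"
  proof (rule orthogonal_proj_equiv[OF p r pr])
    show "r * (v\<^sup>\<star> * y) = v\<^sup>\<star> * y" by (metis r_def v(1) vq mult.assoc)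
    show "v\<^sup>\<star> * y * p = v\<^sup>\<star> * y" by (simp add: mult.assoc y)
    show "p * (d * v) = d * v" by (simp add: d flip: mult.assoc)
    show "d * v * r = d * v" by (metis r_def v(1) qv mult.assoc)
    show "d * v * (v\<^sup>\<star> * y) = p" by (metis d(2) dy v(1) mult.assoc)
    show "v\<^sup>\<star> * y * (d * v) = r" by (metis r_def vq yd mult.assoc)
  qed
  moreover have "proj_equiv q r" unfolding proj_equiv_def r_def using v by blast
  ultimately show ?thesis
    using proj_equiv_sym proj_equiv_trans p q r by blast
qed

section \<open>Weyl type elements\<close>

lemma finite_type_ideal_props:
  fixes F :: "'a::cstar_algebra set"
  assumes "finite_type_ideal TYPE('i) F"
  shows "x \<in> F \<Longrightarrow> y \<in> F \<Longrightarrow> x + y \<in> F" "x \<in> F \<Longrightarrow> y \<in> F \<Longrightarrow> x - y \<in> F"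
    "x \<in> F \<Longrightarrow> y * x \<in> F" "x \<in> F \<Longrightarrow> x * y \<in> F" "x \<in> F \<Longrightarrow> x\<^sup>\<star> \<in> F"
proof -
  have F: "selfadjoint_ideal F" using assms by (simp add: finite_type_ideal_def)
  show add: "x \<in> F \<Longrightarrow> y \<in> F \<Longrightarrow> x + y \<in> F" for x y
    using F by (simp add: selfadjoint_ideal_def subalgebra_def)
  show left: "x \<in> F \<Longrightarrow> y * x \<in> F" for x y
    using F by (simp add: selfadjoint_ideal_def)
  show "x \<in> F \<Longrightarrow> x * y \<in> F" "x \<in> F \<Longrightarrow> x\<^sup>\<star> \<in> F"
    using F by (simp_all add: selfadjoint_ideal_def)
  show "x \<in> F \<Longrightarrow> y \<in> F \<Longrightarrow> x - y \<in> F"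
    using add[of x "- 1 * y"] left[of y "- 1"] by simp
qed

text \<open>The adjoint of the relative inverse works for the reversed pair, which reduces lower
  semi-Weyl type to upper semi-Weyl type.\<close>

lemma invertible_up_to_adj:
  assumes "is_projection p" "is_projection q" "invertible_up_to a p q"
  shows "invertible_up_to (a\<^sup>\<star>) q (p::'a::cstar_algebra)"
proof -
  obtain b where b: "b = (1 - p) * b * (1 - q)" "(1 - q) * a * (1 - p) * b = 1 - q"
      "b * ((1 - q) * a * (1 - p)) = 1 - p"
    using assms(3) unfolding invertible_up_to_def Let_def by blast
  have s: "p\<^sup>\<star> = p" "q\<^sup>\<star> = q" using assms by (simp_all add: is_projection_def)
  have "b\<^sup>\<star> = (1 - q) * b\<^sup>\<star> * (1 - p)"
    by (subst b(1)) (simp add: adj_simps s mult.assoc)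
  moreover have "(1 - p) * a\<^sup>\<star> * (1 - q) * b\<^sup>\<star> = 1 - p"
    using arg_cong[OF b(3), of adj] by (simp add: adj_simps s mult.assoc)
  moreover have "b\<^sup>\<star> * ((1 - p) * a\<^sup>\<star> * (1 - q)) = 1 - q"
    using arg_cong[OF b(2), of adj] by (simp add: adj_simps s mult.assoc)
  ultimately show ?thesis unfolding invertible_up_to_def Let_def by blast
qed

lemma lower_semi_Weyl_iff_adj:
  "a \<in> lower_semi_Weyl F \<longleftrightarrow> a\<^sup>\<star> \<in> upper_semi_Weyl (F :: 'a::cstar_algebra set)"
  unfolding lower_semi_Weyl_def upper_semi_Weyl_def mem_Collect_eq
  by (metis adj_adj invertible_up_to_adj)

lemma right_invertible_iff_adj:
  "right_invertible b \<longleftrightarrow> left_invertible ((b::'a::cstar_algebra)\<^sup>\<star>)"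
  unfolding left_invertible_def right_invertible_def by (metis adj_adj adj_mult adj_one)

text \<open>Splitting \<open>f = f * (1 - p) + f * p\<close>, the first part is small for
  \<open>p\<close> far out in the approximate unit and is absorbed into \<open>b\<close>; the second
  is killed by \<open>1 - p\<close>.\<close>

lemma finite_type_cut_down:
  fixes b c f :: "'a::cstar_algebra"
  assumes F: "finite_type_ideal TYPE('i) F" and f: "f \<in> F" and cb: "c * b = 1"
  obtains p b' c' where "p \<in> F" "is_projection p" "c' * b' = 1" "b * c = 1 \<Longrightarrow> b' * c' = 1"
    "(b + f) * (1 - p) = b' * (1 - p)"
proof -
  obtain I :: "'i set" and le u where u: "approximate_unit F I le u" "\<forall>i\<in>I. is_projection (u i)"
    using F unfolding finite_type_ideal_def by blast
  \<comment> \<open>A tolerance that stays below \<open>1\<close> after multiplication by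
    \<open>norm c\<close>.\<close>
  have "1 / (norm c + 1) > 0" by (simp add: add_nonneg_pos)
  moreover have "net_tendsto I le (\<lambda>i. f * u i) f"
    using u f unfolding approximate_unit_def by blast
  ultimately obtain i where i: "i \<in> I" "\<forall>j\<in>I. le i j \<longrightarrow> norm (f * u j - f) < 1 / (norm c + 1)"
    unfolding net_tendsto_def by blast
  define p where "p = u i"
  have "le i i" using u i unfolding approximate_unit_def directed_set_def by blast
  then have small: "norm (f * p - f) < 1 / (norm c + 1)" using i by (simp add: p_def)
  have p: "p \<in> F" "is_projection p" using u i unfolding approximate_unit_def p_def by blast+
  have pp: "p * p = p" using p by (simp add: is_projection_def)
  define b' where "b' = b + f * (1 - p)"
  have "1 - c * b' = c * (f * p - f)" by (simp add: b'_def algebra_simps cb)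
  then have "norm (1 - c * b') \<le> norm c * norm (f * p - f)" by (simp add: norm_mult_ineq)
  also have "\<dots> \<le> (norm c + 1) * norm (f * p - f)" by (simp add: algebra_simps)
  also have "\<dots> < 1"
    using small by (simp add: pos_less_divide_eq add_nonneg_pos mult.commute)
  finally obtain s where s: "s * (c * b') = 1" "c * b' * s = 1" by (rule neumann_inverse)
  \<comment> \<open>Inserting \<open>b * c = 1\<close> on the left exposes the right inverse
    \<open>s\<close> of \<open>c * b'\<close>.\<close>
  have "b' * (s * c) = 1" if "b * c = 1"
  proof -
    have "b' * (s * c) = (b * c) * b' * (s * c)" by (simp add: that)
    also have "\<dots> = b * (c * b' * s) * c" by (simp only: mult.assoc)
    finally show ?thesis by (simp add: s that)
  qed
  moreover have "(b + f) * (1 - p) = b' * (1 - p)" by (simp add: b'_def algebra_simps pp)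
  ultimately show thesis using that[of p "s * c" b'] p s by (simp add: mult.assoc)
qed

text \<open>
  Here \<open>1 - q\<close> is the range projection of \<open>b (1 - p)\<close> and \<open>p'\<close> that of \<open>q b p\<close>.
\<close>

lemma invertible_up_to_complement:
  fixes a b c p :: "'a::cstar_algebra"
  assumes F: "finite_type_ideal TYPE('i) F" and pF: "p \<in> F" and p: "is_projection p"
    and cb: "c * b = 1" and ab: "a * (1 - p) = b * (1 - p)"
  obtains q p' where "is_projection q" "is_projection p'" "invertible_up_to a p q"
    "proj_le p' q" "proj_equiv p p'" "p' \<in> F" "b * c = 1 \<Longrightarrow> p' = q"
proof -
  have pp: "p * p = p" using p by (simp add: is_projection_def)
  define n where "n = 1 - p"
  have nn: "n * n = n" and pn: "p * n = 0" by (simp_all add: n_def algebra_simps pp)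
  \<comment> \<open>An idempotent with the range of \<open>b * n\<close>; its range projection
    \<open>r\<close> is selfadjoint and serves as \<open>1 - q\<close>.\<close>
  define e where "e = b * n * c"
  have "e * e = b * n * (c * b) * n * c" by (simp only: e_def mult.assoc)
  also have "\<dots> = b * (n * n) * c" by (simp add: cb mult.assoc)
  finally have "e * e = e" by (simp add: nn e_def)
  then obtain r where r: "is_projection r" "r * e = e" "e * r = r" by (rule range_projection)
  define q where "q = 1 - r"
  have q: "is_projection q" unfolding q_def by (rule is_projection_complement[OF r(1)])
  have qq: "q * q = q" using q by (simp add: is_projection_def)
  have rr: "r * r = r" using r by (simp add: is_projection_def)
  have eb: "e * b = b * n" by (simp add: e_def mult.assoc cb)
  have rb: "r * (b * n) = b * n" by (simp add: r(2) flip: eb mult.assoc)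
  have inv: "invertible_up_to a p q"
  proof -
    have q1: "1 - q = r" by (simp add: q_def)
    have a': "(1 - q) * a * (1 - p) = b * n"
      using ab rb by (simp add: q1 n_def mult.assoc)
    have "n * c * r = (1 - p) * (n * c * r) * (1 - q)"
      by (simp only: q1 n_def[symmetric] mult.assoc rr mult_eq_assoc[OF nn])
    moreover have "b * n * (n * c * r) = 1 - q"
    proof -
      have "b * n * (n * c * r) = b * (n * n) * c * r" by (simp only: mult.assoc)
      also have "\<dots> = e * r" by (simp only: nn e_def)
      finally show ?thesis by (simp add: r(3) q1)
    qed
    moreover have "n * c * r * (b * n) = 1 - p"
    proof -
      have "n * c * r * (b * n) = n * (c * (r * (b * n)))" by (simp only: mult.assoc)
      also have "\<dots> = n * n" by (simp only: rb mult_eq_assoc[OF cb] mult_1_left)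
      finally show ?thesis by (simp add: nn) (simp add: n_def)
    qed
    ultimately show ?thesis unfolding invertible_up_to_def Let_def a' by blast
  qed
  have "p * c * e = p * (c * b) * n * c" by (simp only: e_def mult.assoc)
  then have pce: "p * c * e = 0" by (simp add: cb pn)
  have "p * c * r = p * c * e * r" by (simp only: mult.assoc r(3))
  \<comment> \<open>Since \<open>p * c\<close> annihilates \<open>r\<close>, compression by
    \<open>q\<close> loses nothing, and \<open>d\<close> remains a left inverse of \<open>x\<close>
    relative to \<open>p\<close>.\<close>
  then have pcq: "p * c * q = p * c" by (simp add: pce q_def right_diff_distrib)
  define x where "x = q * b * p"
  define d where "d = p * c"
  have dx: "d * x = p"
  proof -
    have "d * x = (p * c * q) * b * p" by (simp only: d_def x_def mult.assoc)
    also have "\<dots> = p * (c * b) * p" by (simp only: pcq) (simp only: mult.assoc)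
    finally show ?thesis by (simp add: cb pp)
  qed
  have xp: "x * p = x" by (simp add: x_def mult.assoc pp)
  have qx: "q * x = x" by (simp add: x_def mult_eq_assoc[OF qq] mult.assoc)
  have pd: "p * d = d" by (simp add: d_def mult_eq_assoc[OF pp])
  \<comment> \<open>An idempotent with the range of \<open>x\<close>; it lies in \<open>F\<close>
    because of the factor \<open>p\<close>.\<close>
  define g where "g = x * d"
  have gx: "g * x = x" by (simp add: g_def mult.assoc dx xp)
  have "g * g = (g * x) * d" by (simp only: g_def mult.assoc)
  then have "g * g = g" by (simp only: gx) (simp only: g_def)
  then obtain p' where p': "is_projection p'" "p' * g = g" "g * p' = p'" by (rule range_projection)
  have "g \<in> F"
    unfolding g_def x_def using finite_type_ideal_props(3,4)[OF F] pF by blast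
  then have p'F: "p' \<in> F" using finite_type_ideal_props(4)[OF F, of g p'] p'(3) by simp
  have qg: "q * g = g" by (simp add: g_def mult_eq_assoc[OF qx])
  have qp': "q * p' = p'" by (metis mult.assoc p'(3) qg)
  have p'q: "p' * q = p'" by (metis adj_mult is_projection_def p'(1) q qp')
  have p'x: "p' * x = x" by (metis gx mult.assoc p'(2))
  have equiv: "proj_equiv p p'"
  proof (rule finite_type_proj_equiv[OF F pF p'F p p'(1)])
    show "p' * x = x" by (rule p'x)
    show "x * p = x" by (rule xp)
    show "p * (d * p') = d * p'" by (simp add: mult_eq_assoc[OF pd])
    show "d * p' * p' = d * p'" using p'(1) by (simp add: mult.assoc is_projection_def)
    show "d * p' * x = p" by (simp add: mult.assoc p'x dx)
    show "x * (d * p') = p'" using p'(3) by (simp add: g_def mult.assoc)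
  qed
  \<comment> \<open>For invertible \<open>b\<close>, \<open>b * p * c\<close> is the complementary
    idempotent \<open>1 - e\<close>, and \<open>q * e = 0\<close> yields
    \<open>g = q\<close>.\<close>
  have "p' = q" if bc: "b * c = 1"
  proof -
    have "q * e = 0" by (simp add: q_def left_diff_distrib r(2))
    moreover have "b * p * c = 1 - e" by (simp add: e_def n_def algebra_simps bc)
    moreover have "g = q * (b * (p * p) * c)" by (simp only: g_def x_def d_def mult.assoc)
    ultimately have "g = q" by (simp add: pp right_diff_distrib)
    then show ?thesis using p'(2) p'q by simp
  qed
  then show thesis
    using that[of q p'] q p'(1) inv equiv p'F qp' p'q by (auto simp: proj_le_def)
qed

section \<open>Characterizations as perturbations of one-sided and two-sided invertible
  elements\<close>

lemma upper_semi_Weyl_iff: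
  fixes F :: "'a::cstar_algebra set"
  assumes F: "finite_type_ideal TYPE('i) F"
  shows "a \<in> upper_semi_Weyl F \<longleftrightarrow> (\<exists>b f. left_invertible b \<and> f \<in> F \<and> a = b + f)"
proof
  assume "a \<in> upper_semi_Weyl F"
  then obtain p q p' v b where p: "is_projection p" "p \<in> F"
    and q: "is_projection q" and p': "proj_le p' q" "is_projection p'"
    and v: "v * v\<^sup>\<star> = p" "v\<^sup>\<star> * v = p'"
    and b: "b = (1 - p) * b * (1 - q)" "b * ((1 - q) * a * (1 - p)) = 1 - p"
    unfolding upper_semi_Weyl_def proj_subequiv_def proj_equiv_def invertible_up_to_def Let_def
    by blast
  have qq: "q * q = q" using q by (simp add: is_projection_def)
  have "b * q = 0" by (subst b(1)) (simp add: mult.assoc left_diff_distrib qq)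
  then have b0: "b * (q * x) = 0" for x by (simp flip: mult.assoc)
  have pv: "p * v = v" using proj_mult_partial_isometry[of v] p by (simp add: v)
  then have vp: "v\<^sup>\<star> * p = v\<^sup>\<star>" by (metis adj_mult is_projection_def p(1))
  have "q * v\<^sup>\<star> = q * (v\<^sup>\<star> * v * v\<^sup>\<star>)" by (simp only: mult.assoc v(1) vp)
  also have "\<dots> = v\<^sup>\<star> * v * v\<^sup>\<star>" using p'(1) by (simp add: v(2) mult_eq_assoc proj_le_def)
  finally have qv: "q * v\<^sup>\<star> = v\<^sup>\<star>" by (simp only: mult.assoc v(1) vp)
  have bv: "b * v\<^sup>\<star> = 0" by (metis b0 qv)
  have ba: "b * a * (1 - p) = 1 - p"
    using b(2) by (simp add: left_diff_distrib right_diff_distrib mult.assoc b0)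
  define w where "w = a * (1 - p) + v\<^sup>\<star>"
  have bw: "b * w = 1 - p" using ba bv by (simp add: w_def distrib_left mult.assoc)
  have "v * w = v * a * (1 - p) + p" by (simp only: w_def distrib_left mult.assoc v(1))
  moreover have "v * a * b * w = v * a * (1 - p)" by (simp only: mult.assoc bw)
  \<comment> \<open>The sum \<open>b + v\<close> produces \<open>1\<close> plus the cross term
    \<open>v * a * (1 - p)\<close>; subtracting \<open>v * a * b\<close> cancels it.\<close>
  ultimately have "(b + v - v * a * b) * w = 1"
    by (simp only: left_diff_distrib distrib_right bw) simp
  then have "left_invertible w" unfolding left_invertible_def by blast
  \<comment> \<open>Membership rests on \<open>p\<close> in \<open>F\<close> and
    \<open>v\<^sup>\<star> = v\<^sup>\<star> * p\<close>.\<close>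
  moreover have "a * p - v\<^sup>\<star> \<in> F"
    using finite_type_ideal_props[OF F] p(2) vp by metis
  moreover have "a = w + (a * p - v\<^sup>\<star>)" by (simp add: w_def algebra_simps)
  ultimately show "\<exists>b f. left_invertible b \<and> f \<in> F \<and> a = b + f" by blast
next
  assume "\<exists>b f. left_invertible b \<and> f \<in> F \<and> a = b + f"
  then obtain b c f where cb: "c * b = 1" and f: "f \<in> F" and a: "a = b + f"
    unfolding left_invertible_def by blast
  obtain p b' c' where p: "p \<in> F" "is_projection p" and cb': "c' * b' = 1"
    and ab: "a * (1 - p) = b' * (1 - p)"
    using finite_type_cut_down[OF F f cb] unfolding a by metis
  obtain q p' where "is_projection q" "is_projection p'" "invertible_up_to a p q"
      "proj_le p' q" "proj_equiv p p'"
    using invertible_up_to_complement[OF F p cb' ab] by metis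
  then show "a \<in> upper_semi_Weyl F"
    using p unfolding upper_semi_Weyl_def proj_subequiv_def by blast
qed

lemma lower_semi_Weyl_iff:
  fixes F :: "'a::cstar_algebra set"
  assumes F: "finite_type_ideal TYPE('i) F"
  shows "a \<in> lower_semi_Weyl F \<longleftrightarrow> (\<exists>b f. right_invertible b \<and> f \<in> F \<and> a = b + f)"
  unfolding lower_semi_Weyl_iff_adj upper_semi_Weyl_iff[OF F] right_invertible_iff_adj
  by (metis adj_add adj_adj finite_type_ideal_props(5)[OF F])

lemma Weyl_iff:
  fixes F :: "'a::cstar_algebra set"
  assumes F: "finite_type_ideal TYPE('i) F"
  shows "a \<in> Weyl F \<longleftrightarrow> (\<exists>b f. two_sided_invertible b \<and> f \<in> F \<and> a = b + f)"
proof
  assume "a \<in> Weyl F"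
  then obtain p q v b where p: "is_projection p" "p \<in> F" and q: "is_projection q" "q \<in> F"
    and v: "v * v\<^sup>\<star> = p" "v\<^sup>\<star> * v = q"
    and b: "b = (1 - p) * b * (1 - q)" "(1 - q) * a * (1 - p) * b = 1 - q"
      "b * ((1 - q) * a * (1 - p)) = 1 - p"
    unfolding Weyl_def proj_equiv_def invertible_up_to_def Let_def by blast
  define a' where "a' = (1 - q) * a * (1 - p)"
  have pp: "p * p = p" "p\<^sup>\<star> = p" and qq: "q * q = q" "q\<^sup>\<star> = q"
    using p q by (simp_all add: is_projection_def)
  have pv: "p * v = v" using proj_mult_partial_isometry[of v] p by (simp add: v)
  have vp: "v\<^sup>\<star> * p = v\<^sup>\<star>" by (metis adj_mult pp(2) pv)
  have vq: "v * q = v" by (metis mult.assoc pv v)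
  have qv: "q * v\<^sup>\<star> = v\<^sup>\<star>" by (metis adj_mult qq(2) vq)
  have "b * q = 0" by (subst b(1)) (simp add: mult.assoc left_diff_distrib qq)
  then have bv: "b * v\<^sup>\<star> = 0" by (metis mult.assoc mult_zero_left qv)
  have "p * b = 0" by (subst b(1)) (simp add: right_diff_distrib pp flip: mult.assoc)
  then have vb: "v\<^sup>\<star> * b = 0" by (metis mult.assoc mult_zero_right vp)
  have "a' * p = 0" by (simp add: a'_def mult.assoc left_diff_distrib pp)
  then have av: "a' * v = 0" by (metis mult.assoc mult_zero_left pv)
  have "q * a' = 0" by (simp add: a'_def right_diff_distrib qq flip: mult.assoc)
  then have va: "v * a' = 0" by (metis mult.assoc mult_zero_right vq)
  \<comment> \<open>In block form, \<open>b\<close> inverts \<open>a'\<close> between the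
    complements of \<open>p\<close> and \<open>q\<close>, while \<open>v\<close> inverts
    \<open>v\<^sup>\<star>\<close> between \<open>p\<close> and \<open>q\<close>; the mixed products
    vanish.\<close>
  have "(b + v) * (a' + v\<^sup>\<star>) = 1" "(a' + v\<^sup>\<star>) * (b + v) = 1"
    using b(2,3) by (simp_all add: distrib_left distrib_right bv vb av va v flip: a'_def)
  then have "two_sided_invertible (a' + v\<^sup>\<star>)" unfolding two_sided_invertible_def by blast
  moreover have "q * a + (1 - q) * a * p - v\<^sup>\<star> * p \<in> F"
    using finite_type_ideal_props[OF F] p(2) q(2) by metis
  moreover have "a = (a' + v\<^sup>\<star>) + (q * a + (1 - q) * a * p - v\<^sup>\<star> * p)"
    by (simp add: a'_def vp algebra_simps)
  ultimately show "\<exists>b f. two_sided_invertible b \<and> f \<in> F \<and> a = b + f" by blast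
next
  assume "\<exists>b f. two_sided_invertible b \<and> f \<in> F \<and> a = b + f"
  then obtain b c f where cb: "c * b = 1" "b * c = 1" and f: "f \<in> F" and a: "a = b + f"
    unfolding two_sided_invertible_def by blast
  obtain p b' c' where p: "p \<in> F" "is_projection p" and cb': "c' * b' = 1" "b' * c' = 1"
    and ab: "a * (1 - p) = b' * (1 - p)"
    using finite_type_cut_down[OF F f cb(1)] cb(2) unfolding a by metis
  \<comment> \<open>As \<open>b'\<close> is invertible, the subprojection of \<open>q\<close>
    equivalent to \<open>p\<close> is \<open>q\<close> itself.\<close>
  obtain q where "is_projection q" "invertible_up_to a p q" "proj_equiv p q" "q \<in> F"
    using invertible_up_to_complement[OF F p cb'(1) ab] cb'(2) by metis
  then show "a \<in> Weyl F"
    using p unfolding Weyl_def by blast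
qed

theorem proposition3p20:
  fixes F :: "'a::cstar_algebra set" and a :: 'a
  assumes "finite_type_ideal TYPE('i) F"
  shows "(a \<in> upper_semi_Weyl F \<longleftrightarrow> (\<exists>b f. left_invertible b \<and> f \<in> F \<and> a = b + f))
       \<and> (a \<in> lower_semi_Weyl F \<longleftrightarrow> (\<exists>b f. right_invertible b \<and> f \<in> F \<and> a = b + f))
       \<and> (a \<in> Weyl F \<longleftrightarrow> (\<exists>b f. two_sided_invertible b \<and> f \<in> F \<and> a = b + f))"
  using upper_semi_Weyl_iff[OF assms] lower_semi_Weyl_iff[OF assms] Weyl_iff[OF assms] by blast

end
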